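(* Let $X=(X_t)_{t\in\mathbb{Z}^+}$ be a discrete-time Markov chain with discrete state space $S$ and transition matrix $P$, such that $N(x)=\{y: P(x,y)>0\}$ is finite for each $x\in S$. Let $f: S \to \mathbb{R}$ be a function. Suppose the set $S_0\subseteq S$ and functions $a_{x,i}: S_0 \to \mathbb{R}$ ($x\in S_0$, $i\in \mathbb{Z}^+$) are such that $$|\mathbb{E}_x [f(X_i)] - \mathbb{E}_y [f(X_i)]| \le a_{x,i}(y), \quad i \in \mathbb{Z}^+, \ x,y \in S_0.$$ Let $S_0^0 = \{x \in S_0: N(x) \subseteq S_0 \}$. Assume that, for some sequence $(\alpha_i)_{i \in \mathbb{Z}^+}$ of positive constants, $$\sup_{x \in S_0^0} (P a_{x,i}^2)(x) \le \alpha_i^2\quad\text{for all } i\in\mathbb{Z}^+.$$ Let $t >0$ be an integer, and let $\beta = 2\sum_{i=0}^{t-1}\alpha_i^2$. Suppose also that $\alpha$ is such that $$2\sup_{0 \le i \le t -1}\ \sup_{x \in S^0_0,\, y \in N(x)} a_{x,i}(y) \le \alpha.$$ Finally, let $A_t= \{X_s \in S_0^0 \text{ for all } 0 \le s \le t-1\}$. Then, for all $x_0\in S$ and all $a >0$, $$\mathbb{P}_{x_0} \Big ( \{ |f(X_t)-\mathbb{E}_{x_0} [f(X_t)] |\ge a \} \cap A_t \Big) \le 2\exp\Big(-\frac{a^2}{2\beta+2\alpha a/3}\Big).$$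
   Context: $\mathbb{Z}^+=\{0,1,2,\dots\}$. $\mathbb{P}_{x}$ and $\mathbb{E}_{x}$ denote the law of the chain, and the corresponding expectation, conditional on $X_0=x$. The chain may be lazy, i.e. $P(x,x)>0$ is allowed. For $x\in S_0^0$, $(P a_{x,i}^2)(x)=\sum_{y\in N(x)}P(x,y)\,a_{x,i}(y)^2$. *)

theory Defs
  imports "HOL-Probability.Probability"
begin

definition stochastic_matrix :: "('s \<Rightarrow> 's \<Rightarrow> real) \<Rightarrow> bool" where
  "stochastic_matrix P \<longleftrightarrow> (\<forall>x y. 0 \<le> P x y) \<and> (\<forall>x. (P x has_sum 1) UNIV)"

text \<open>
  A time-homogeneous Markov chain with transition matrix \<open>P\<close> started in the state \<open>x\<close>, realised
  by a process \<open>X\<close> on a probability space \<open>M\<close>. The state space is the type \<open>'s\<close> with the discrete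
  sigma-algebra. A family \<open>(M x)\<close>, indexed by the states \<open>x\<close>, of such probability measures for a
  common process \<open>X\<close> is what is usually written \<open>(\<P>\<^sub>x)\<close>; it avoids conditioning on an event
  \<open>X\<^sub>0 = x\<close> of probability zero.
\<close>

locale markov_chain_from = prob_space M
  for M :: "'w measure" and P :: "'s \<Rightarrow> 's \<Rightarrow> real" and X :: "nat \<Rightarrow> 'w \<Rightarrow> 's" and x :: 's +
  assumes stochastic: "stochastic_matrix P"
    and measurable_X: "\<And>n. X n \<in> measurable M (count_space UNIV)"
    and start: "AE \<omega> in M. X 0 \<omega> = x"
    and markov: "\<And>n (z :: nat \<Rightarrow> 's) y. \<P>(\<omega> in M. \<forall>k\<le>n. X k \<omega> = z k) > 0 \<Longrightarrow>
        \<P>(\<omega> in M. X (Suc n) \<omega> = y \<bar> \<forall>k\<le>n. X k \<omega> = z k) = P (z n) y"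

definition nbrs :: "('s \<Rightarrow> 's \<Rightarrow> real) \<Rightarrow> 's \<Rightarrow> 's set" where
  "nbrs P x = {y. P x y > 0}"

definition inner_states :: "('s \<Rightarrow> 's \<Rightarrow> real) \<Rightarrow> 's set \<Rightarrow> 's set" where
  "inner_states P S0 = {x \<in> S0. nbrs P x \<subseteq> S0}"

text \<open>
  The action of \<open>P\<close> on a function. The sum runs over \<open>nbrs P x\<close> only, so it is a finite sum when
  \<open>nbrs P x\<close> is finite, and it depends only on the values of \<open>g\<close> there.
\<close>

definition trans_op :: "('s \<Rightarrow> 's \<Rightarrow> real) \<Rightarrow> ('s \<Rightarrow> real) \<Rightarrow> 's \<Rightarrow> real" where
  "trans_op P g x = (\<Sum>y\<in>nbrs P x. P x y * g y)"

end

theory Submission imports Defs begin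

text \<open>
  Writing \<open>h i = P\<^sup>i f\<close>, so that \<open>h i x\<close> is the mean of \<open>f (X\<^sub>i)\<close> for the chain started in \<open>x\<close>, the
  process \<open>h (t - s) (X\<^sub>s)\<close> is the Doob martingale of \<open>f (X\<^sub>t)\<close>. In a step from an inner state \<open>x\<close>
  its increment is \<open>h i y - h (Suc i) x\<close>, where \<open>h (Suc i) x\<close> is the mean of \<open>h i\<close> over the
  neighbours; replacing this centre by \<open>h i x\<close> can only increase the second moment, and costs a factor 2
  in the uniform bound. The hypotheses on \<open>a\<close> thus control both, and Bernstein's argument applies
  to the exponential moment restricted to paths that stay in the inner states. It would even give the
  tail bound with \<open>\<beta> / 2\<close> in place of \<open>\<beta>\<close>. Since every state has finitely many neighbours, the
  chain has finitely many paths of given length up to a null set, and all expectations are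
  finite sums.
\<close>

section \<open>The transition operator and the states reachable in n steps\<close>

lemma trans_op_mono:
  assumes "\<And>x y. 0 \<le> P x y" "\<And>y. y \<in> nbrs P x \<Longrightarrow> g y \<le> h y"
  shows "trans_op P g x \<le> trans_op P h x"
  unfolding trans_op_def using assms by (intro sum_mono mult_left_mono) auto

text \<open>The type of states may be uncountable, but \<open>X n\<close> almost surely lies in this
  set, which is finite when all neighbourhoods are. Integrability and every exchange of quantifier
  and null set rest on that.\<close>

primrec reach :: "('s \<Rightarrow> 's \<Rightarrow> real) \<Rightarrow> 's \<Rightarrow> nat \<Rightarrow> 's set" where
  "reach P x 0 = {x}"
| "reach P x (Suc n) = (\<Union>y\<in>reach P x n. nbrs P y)"

lemma finite_reach:
  assumes "\<And>x. finite (nbrs P x)"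
  shows "finite (reach P x n)"
  using assms by (induction n) auto

lemma stochastic_matrix_sum_nbrs:
  assumes "stochastic_matrix P" "finite (nbrs P x)"
  shows "(\<Sum>y\<in>nbrs P x. P x y) = 1"
proof -
  have "(P x has_sum 1) UNIV" and nn: "\<And>y. 0 \<le> P x y"
    using assms(1) by (auto simp: stochastic_matrix_def)
  moreover have "(P x has_sum 1) UNIV \<longleftrightarrow> (P x has_sum 1) (nbrs P x)"
    using nn by (intro has_sum_cong_neutral) (auto simp: nbrs_def intro: antisym simp: not_less)
  ultimately show ?thesis
    using assms(2) by (simp add: has_sum_finite_iff)
qed

lemma trans_op_add:
  "trans_op P (\<lambda>y. g y + h y) x = trans_op P g x + trans_op P h x"
  by (simp add: trans_op_def sum.distrib algebra_simps)

lemma trans_op_cmult: "trans_op P (\<lambda>y. c * g y) x = c * trans_op P g x"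
  by (simp add: trans_op_def sum_distrib_left algebra_simps)

lemma trans_op_uminus: "trans_op P (\<lambda>y. - g y) = (\<lambda>x. - trans_op P g x)"
  by (simp add: trans_op_def sum_negf fun_eq_iff)

text \<open>Serves the lower tail, which is the upper tail of the negated function.\<close>

lemma funpow_trans_op_uminus:
  "(trans_op P ^^ n) (\<lambda>y. - g y) = (\<lambda>x. - (trans_op P ^^ n) g x)"
  by (induction n) (simp_all add: trans_op_uminus)

lemma trans_op_const:
  assumes "stochastic_matrix P" "finite (nbrs P x)"
  shows "trans_op P (\<lambda>y. c) x = c"
  using stochastic_matrix_sum_nbrs[OF assms] by (simp add: trans_op_def flip: sum_distrib_right)

section \<open>From the Markov property on single paths to expectations\<close>

context markov_chain_from
begin

text \<open>One notion for two uses: singletons \<open>B k\<close> fix a path up to time n, and a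
  constant \<open>B\<close> confines the path to a set.\<close>

definition cylinder :: "nat \<Rightarrow> (nat \<Rightarrow> 's set) \<Rightarrow> 'w set" where
  "cylinder n B = {\<omega>\<in>space M. \<forall>k\<le>n. X k \<omega> \<in> B k}"

lemma measurable_comp_X [measurable]: "(\<lambda>\<omega>. (g (X n \<omega>) :: real)) \<in> borel_measurable M"
  using measurable_compose[OF measurable_X, of g borel n] by simp

lemma pred_X_mem [measurable]: "Measurable.pred M (\<lambda>\<omega>. X n \<omega> \<in> B)"
  using measurable_compose[OF measurable_X, of "\<lambda>s. s \<in> B" "count_space UNIV" n] by simp

lemma sets_cylinder [measurable]: "cylinder n B \<in> sets M"
  unfolding cylinder_def by measurable

text \<open>The product form of \<open>markov\<close> also covers conditioning events of probability
  zero, where both sides vanish.\<close>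

lemma prob_step:
  "prob (cylinder n (\<lambda>k. {z k}) \<inter> {\<omega>\<in>space M. X (Suc n) \<omega> = y})
    = prob (cylinder n (\<lambda>k. {z k})) * P (z n) y"
proof (cases "prob (cylinder n (\<lambda>k. {z k})) > 0")
  case True
  then have "\<P>(\<omega> in M. X (Suc n) \<omega> = y \<bar> \<forall>k\<le>n. X k \<omega> = z k) = P (z n) y"
    using markov[of n z y] by (simp add: cylinder_def)
  moreover have "cylinder n (\<lambda>k. {z k}) \<inter> {\<omega>\<in>space M. X (Suc n) \<omega> = y}
      = {\<omega>\<in>space M. X (Suc n) \<omega> = y \<and> (\<forall>k\<le>n. X k \<omega> = z k)}"
    by (auto simp: cylinder_def)
  ultimately show ?thesis
    using True by (simp add: cond_prob_def cylinder_def field_simps)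
next
  case False
  then have "prob (cylinder n (\<lambda>k. {z k})) = 0"
    using measure_nonneg[of M "cylinder n (\<lambda>k. {z k})"] by linarith
  moreover have "prob (cylinder n (\<lambda>k. {z k}) \<inter> {\<omega>\<in>space M. X (Suc n) \<omega> = y})
      \<le> prob (cylinder n (\<lambda>k. {z k}))"
    by (intro finite_measure_mono) auto
  ultimately show ?thesis
    using measure_nonneg[of M "cylinder n (\<lambda>k. {z k}) \<inter> {\<omega>\<in>space M. X (Suc n) \<omega> = y}"]
    by simp
qed

text \<open>The non-neighbours may be uncountably many, so it does not suffice that each has
  probability zero. Instead mass is counted: the finitely many neighbours already carry the whole
  probability of the cylinder, because the row of \<open>P\<close> sums to one.\<close>

lemma AE_step:
  assumes fin: "\<And>x. finite (nbrs P x)"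
  shows "AE \<omega> in M. \<omega> \<in> cylinder n (\<lambda>k. {z k}) \<longrightarrow> X (Suc n) \<omega> \<in> nbrs P (z n)"
proof -
  let ?C = "cylinder n (\<lambda>k. {z k})"
  let ?D = "?C \<inter> {\<omega>\<in>space M. X (Suc n) \<omega> \<in> nbrs P (z n)}"
  have sets1: "{\<omega>\<in>space M. X (Suc n) \<omega> = y} \<in> sets M" for y
    using pred_X_mem[of "Suc n" "{y}"] by (simp add: pred_def)
  have D: "?D \<in> sets M"
    by measurable
  have "?D = (\<Union>y\<in>nbrs P (z n). ?C \<inter> {\<omega>\<in>space M. X (Suc n) \<omega> = y})"
    by auto
  then have "prob ?D = prob (\<Union>y\<in>nbrs P (z n). ?C \<inter> {\<omega>\<in>space M. X (Suc n) \<omega> = y})"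
    by (rule arg_cong)
  also have "\<dots> = (\<Sum>y\<in>nbrs P (z n). prob (?C \<inter> {\<omega>\<in>space M. X (Suc n) \<omega> = y}))"
    using sets1 fin by (intro finite_measure_finite_Union) (auto simp: disjoint_family_on_def)
  also have "\<dots> = prob ?C"
    by (simp add: prob_step stochastic_matrix_sum_nbrs[OF stochastic fin] flip: sum_distrib_left)
  finally have "prob (?C - ?D) = 0"
    using D by (subst finite_measure_Diff) auto
  then have "AE \<omega> in M. \<omega> \<notin> ?C - ?D"
    using D by (intro AE_not_in) (auto simp: null_sets_def emeasure_eq_measure)
  then show ?thesis
    using AE_space by eventually_elim auto
qed

text \<open>Up to time n only finitely many paths run through the sets \<open>reach P x k\<close>,
  so the exceptional null sets of \<open>AE_step\<close> for all of them can be united.\<close>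

lemma AE_reach:
  assumes fin: "\<And>x. finite (nbrs P x)"
  shows "AE \<omega> in M. \<forall>k\<le>n. X k \<omega> \<in> reach P x k"
proof (induction n)
  case 0
  then show ?case using start by simp
next
  case (Suc n)
  have "AE \<omega> in M. \<forall>z\<in>PiE {..n} (reach P x).
      \<omega> \<in> cylinder n (\<lambda>k. {z k}) \<longrightarrow> X (Suc n) \<omega> \<in> nbrs P (z n)"
    using finite_reach[of P, OF fin] AE_step[OF fin]
    by (intro AE_finite_allI finite_PiE) auto
  with Suc AE_space show ?case
  proof eventually_elim
    case (elim \<omega>)
    \<comment> \<open>The path that is actually observed, cut off after time n so that it is an
      element of the \<open>PiE\<close> set.\<close>
    let ?z = "restrict (\<lambda>k. X k \<omega>) {..n}"
    have "?z \<in> PiE {..n} (reach P x)"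
      using elim(1) by auto
    moreover have "\<omega> \<in> cylinder n (\<lambda>k. {?z k})"
      using elim(2) by (auto simp: cylinder_def)
    ultimately have "X (Suc n) \<omega> \<in> nbrs P (X n \<omega>)"
      using elim(3) by fastforce
    with elim(1) show ?case
      by (auto simp: le_Suc_eq)
  qed
qed

text \<open>Even an unbounded \<open>g\<close> is almost surely bounded at time n, by the sum of its
  absolute values over the finite set of reachable states.\<close>

lemma integrable_comp_X:
  fixes g :: "'s \<Rightarrow> real"
  assumes fin: "\<And>x. finite (nbrs P x)"
  shows "integrable M (\<lambda>\<omega>. g (X n \<omega>))"
proof (rule integrable_const_bound)
  show "AE \<omega> in M. norm (g (X n \<omega>)) \<le> (\<Sum>y\<in>reach P x n. \<bar>g y\<bar>)"
    using AE_reach[OF fin, of n]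
  proof eventually_elim
    case (elim \<omega>)
    then show ?case
      using member_le_sum[of "X n \<omega>" "reach P x n" "\<lambda>y. \<bar>g y\<bar>"] finite_reach[of P, OF fin]
      by auto
  qed
qed measurable

lemma integrable_cylinder:
  fixes g :: "'s \<Rightarrow> real"
  assumes fin: "\<And>x. finite (nbrs P x)"
  shows "integrable M (\<lambda>\<omega>. indicator (cylinder m B) \<omega> * g (X n \<omega>))"
  using integrable_real_mult_indicator[OF sets_cylinder integrable_comp_X[OF fin]]
  by (simp add: mult.commute)

lemma expectation_path_step:
  assumes fin: "\<And>x. finite (nbrs P x)"
  shows "expectation (\<lambda>\<omega>. indicator (cylinder n (\<lambda>k. {z k})) \<omega> * g (X (Suc n) \<omega>))
    = expectation (\<lambda>\<omega>. indicator (cylinder n (\<lambda>k. {z k})) \<omega> * trans_op P g (X n \<omega>))"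
proof -
  let ?C = "cylinder n (\<lambda>k. {z k})"
  let ?D = "\<lambda>y. ?C \<inter> {\<omega>\<in>space M. X (Suc n) \<omega> = y}"
  have D [measurable]: "?D y \<in> sets M" for y
    using pred_X_mem[of "Suc n" "{y}"] by (auto simp: pred_def)
  \<comment> \<open>On the cylinder exactly one neighbour equals \<open>X (Suc n)\<close>, so the
    sum picks out one term.\<close>
  have eq: "AE \<omega> in M. indicator ?C \<omega> * g (X (Suc n) \<omega>)
      = (\<Sum>y\<in>nbrs P (z n). g y * indicator (?D y) \<omega>)"
    using AE_step[OF fin, of n z] AE_space
  proof eventually_elim
    case (elim \<omega>)
    have "(\<Sum>y\<in>nbrs P (z n). g y * indicator (?D y) \<omega>)
        = (\<Sum>y\<in>nbrs P (z n). if X (Suc n) \<omega> = y then g y * indicator ?C \<omega> else 0)"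
      using elim(2) by (intro sum.cong) (auto simp: indicator_def)
    also have "\<dots> = indicator ?C \<omega> * g (X (Suc n) \<omega>)"
      using elim(1) fin by (auto simp: sum.delta' indicator_def)
    finally show ?case ..
  qed
  have "expectation (\<lambda>\<omega>. indicator ?C \<omega> * g (X (Suc n) \<omega>))
      = expectation (\<lambda>\<omega>. \<Sum>y\<in>nbrs P (z n). g y * indicator (?D y) \<omega>)"
    by (intro integral_cong_AE eq) measurable
  also have "\<dots> = (\<Sum>y\<in>nbrs P (z n). g y * prob (?D y))"
    by (subst Bochner_Integration.integral_sum)
      (auto intro!: integrable_mult_right integrable_real_indicator simp: less_top[symmetric])
  also have "\<dots> = trans_op P g (z n) * prob ?C"
    by (simp add: prob_step trans_op_def sum_distrib_left sum_distrib_right algebra_simps)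
  also have "\<dots> = expectation (\<lambda>\<omega>. indicator ?C \<omega> * trans_op P g (z n))"
    by simp
  also have "\<dots> = expectation (\<lambda>\<omega>. indicator ?C \<omega> * trans_op P g (X n \<omega>))"
    by (intro Bochner_Integration.integral_cong) (auto simp: cylinder_def indicator_def)
  finally show ?thesis .
qed

text \<open>Up to a null set a cylinder is a finite disjoint union of single-path cylinders.
  \<open>H\<close> is arbitrary, so that it may depend on the state after time n as well as on the
  state at time n.\<close>

lemma AE_indicator_cylinder:
  fixes H :: "'w \<Rightarrow> real"
  assumes fin: "\<And>x. finite (nbrs P x)"
  shows "AE \<omega> in M. indicator (cylinder n B) \<omega> * H \<omega>
    = (\<Sum>z\<in>PiE {..n} (\<lambda>k. reach P x k \<inter> B k). indicator (cylinder n (\<lambda>k. {z k})) \<omega> * H \<omega>)"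
  using AE_reach[OF fin, of n] AE_space
proof eventually_elim
  case (elim \<omega>)
  let ?Z = "PiE {..n} (\<lambda>k. reach P x k \<inter> B k)"
  define z\<^sub>0 where "z\<^sub>0 = restrict (\<lambda>k. X k \<omega>) {..n}"
  have "finite ?Z"
    using finite_reach[of P, OF fin] by (intro finite_PiE) auto
  have path: "\<omega> \<in> cylinder n (\<lambda>k. {z k}) \<longleftrightarrow> z = z\<^sub>0" if "z \<in> ?Z" for z
  proof
    assume "\<omega> \<in> cylinder n (\<lambda>k. {z k})"
    then show "z = z\<^sub>0"
      using that by (auto simp: z\<^sub>0_def cylinder_def fun_eq_iff PiE_def extensional_def)
  qed (use elim in \<open>auto simp: cylinder_def z\<^sub>0_def\<close>)
  have "z\<^sub>0 \<in> ?Z \<longleftrightarrow> \<omega> \<in> cylinder n B"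
    using elim by (auto simp: z\<^sub>0_def cylinder_def PiE_def Pi_def)
  moreover have "(\<Sum>z\<in>?Z. indicator (cylinder n (\<lambda>k. {z k})) \<omega> * H \<omega>)
      = (\<Sum>z\<in>?Z. if z = z\<^sub>0 then H \<omega> else 0)"
    using path by (intro sum.cong) (simp_all add: indicator_def)
  ultimately show ?case
    using \<open>finite ?Z\<close> by (simp add: sum.delta indicator_def)
qed

text \<open>The Markov property in the form used later: both sides split over the same finite set of
  paths, and they agree path by path.\<close>

lemma expectation_cylinder_step:
  assumes fin: "\<And>x. finite (nbrs P x)"
  shows "expectation (\<lambda>\<omega>. indicator (cylinder n B) \<omega> * g (X (Suc n) \<omega>))
    = expectation (\<lambda>\<omega>. indicator (cylinder n B) \<omega> * trans_op P g (X n \<omega>))"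
proof -
  let ?Z = "PiE {..n} (\<lambda>k. reach P x k \<inter> B k)"
  have decomp: "expectation (\<lambda>\<omega>. indicator (cylinder n B) \<omega> * h (X m \<omega>))
      = (\<Sum>z\<in>?Z. expectation (\<lambda>\<omega>. indicator (cylinder n (\<lambda>k. {z k})) \<omega> * h (X m \<omega>)))"
    for h :: "'s \<Rightarrow> real" and m
  proof -
    have "expectation (\<lambda>\<omega>. indicator (cylinder n B) \<omega> * h (X m \<omega>))
      = expectation (\<lambda>\<omega>. \<Sum>z\<in>?Z. indicator (cylinder n (\<lambda>k. {z k})) \<omega> * h (X m \<omega>))"
      by (intro integral_cong_AE AE_indicator_cylinder fin) measurable
    also have "\<dots> = (\<Sum>z\<in>?Z. expectation (\<lambda>\<omega>. indicator (cylinder n (\<lambda>k. {z k})) \<omega> * h (X m \<omega>)))"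
      using integrable_cylinder[OF fin] by (intro Bochner_Integration.integral_sum)
    finally show ?thesis .
  qed
  show ?thesis
    unfolding decomp by (intro sum.cong refl expectation_path_step fin)
qed

lemma expectation_eq_funpow_trans_op:
  assumes fin: "\<And>x. finite (nbrs P x)"
  shows "expectation (\<lambda>\<omega>. g (X n \<omega>)) = (trans_op P ^^ n) g x"
\<comment> \<open>The last step of the chain turns \<open>g\<close> into
  \<open>trans_op P g\<close>, so the induction must allow \<open>g\<close> to vary.\<close>
proof (induction n arbitrary: g)
  case 0
  have "expectation (\<lambda>\<omega>. g (X 0 \<omega>)) = expectation (\<lambda>\<omega>. g x)"
    using start by (intro integral_cong_AE) auto
  then show ?case
    by (simp add: prob_space)
next
  case (Suc n)
  have "expectation (\<lambda>\<omega>. indicator (cylinder n (\<lambda>_. UNIV)) \<omega> * h (X m \<omega>))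
      = expectation (\<lambda>\<omega>. h (X m \<omega>))" for h :: "'s \<Rightarrow> real" and m
    by (intro Bochner_Integration.integral_cong) (auto simp: cylinder_def)
  then have "expectation (\<lambda>\<omega>. g (X (Suc n) \<omega>)) = expectation (\<lambda>\<omega>. trans_op P g (X n \<omega>))"
    using expectation_cylinder_step[OF fin, of n "\<lambda>_. UNIV" g] by simp
  with Suc.IH[of "trans_op P g"] show ?case
    by (simp add: funpow_swap1)
qed

end

section \<open>Bernstein's estimate for one step of the chain\<close>

lemma exp_le_Bernstein:
  fixes y b :: real
  assumes "\<bar>y\<bar> \<le> b" "b < 3"
  shows "exp y \<le> 1 + y + y\<^sup>2 / (2 * (1 - b / 3))"
proof -
  have b: "0 \<le> b" "norm (b / 3) < 1"
    using assms by auto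
  \<comment> \<open>Each new factor is at least 3. The exponential series from its quadratic term on
    is therefore dominated by a geometric series with ratio \<open>b / 3\<close>, which converges
    because \<open>b < 3\<close>.\<close>
  have fact_ge: "2 * 3 ^ n \<le> (fact (n + 2) :: real)" for n
  proof (induction n)
    case (Suc n)
    have "2 * 3 ^ Suc n = 3 * (2 * 3 ^ n :: real)"
      by simp
    also have "\<dots> \<le> real (n + 3) * fact (n + 2)"
      using Suc by (intro mult_mono) auto
    also have "\<dots> = fact (Suc n + 2)"
      by (simp add: algebra_simps)
    finally show ?case .
  qed simp
  have term_le: "inverse (fact (n + 2)) * y ^ (n + 2) \<le> y\<^sup>2 / 2 * (b / 3) ^ n" for n
  proof -
    have "inverse (fact (n + 2)) * y ^ (n + 2) \<le> inverse (fact (n + 2)) * (\<bar>y\<bar> ^ n * y\<^sup>2)"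
      using abs_ge_self[of "y ^ n"]
      by (intro mult_left_mono) (simp_all only: power_add power_abs mult_right_mono zero_le_power2
          inverse_nonnegative_iff_nonnegative fact_ge_zero)
    also have "\<dots> \<le> inverse (2 * 3 ^ n) * (b ^ n * y\<^sup>2)"
      using fact_ge assms(1) b(1)
      by (intro mult_mono[OF le_imp_inverse_le mult_right_mono[OF power_mono]]) simp_all
    also have "\<dots> = y\<^sup>2 / 2 * (b / 3) ^ n"
      by (simp add: field_simps)
    finally show ?thesis .
  qed
  have "(\<Sum>n. inverse (fact (n + 2)) * y ^ (n + 2)) \<le> (\<Sum>n. y\<^sup>2 / 2 * (b / 3) ^ n)"
    using summable_exp[of y, THEN summable_ignore_initial_segment, of 2]
    by (intro suminf_le term_le summable_mult summable_geometric b) auto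
  also have "\<dots> = y\<^sup>2 / 2 * (1 / (1 - b / 3))"
    using b by (simp only: suminf_mult summable_geometric suminf_geometric)
  finally show ?thesis
    by (simp add: exp_first_two_terms)
qed

text \<open>The centre \<open>c\<close> is free, since the bounds available later are about the
  value at the starting state and not about the mean. The proof transfers both bounds to the mean
  \<open>m\<close> and then averages \<open>exp_le_Bernstein\<close>.\<close>

lemma trans_op_exp_le:
  fixes g :: "'s \<Rightarrow> real"
  assumes P: "stochastic_matrix P" "finite (nbrs P x)"
    and \<theta>: "0 \<le> \<theta>" "\<theta> * \<alpha> < 3"
    and var: "trans_op P (\<lambda>y. (g y - c)\<^sup>2) x \<le> v"
    and jump: "\<And>y. y \<in> nbrs P x \<Longrightarrow> 2 * \<bar>g y - c\<bar> \<le> \<alpha>"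
  shows "trans_op P (\<lambda>y. exp (\<theta> * g y)) x
    \<le> exp (\<theta> * trans_op P g x + \<theta>\<^sup>2 / (2 * (1 - \<theta> * \<alpha> / 3)) * v)"
proof -
  define m where "m = trans_op P g x"
  define K where "K = \<theta>\<^sup>2 / (2 * (1 - \<theta> * \<alpha> / 3))"
  have nn: "0 \<le> P x y" for x y
    using P by (auto simp: stochastic_matrix_def)
  have const: "trans_op P (\<lambda>_. d) x = d" for d
    using trans_op_const[OF P] .
  have K: "0 \<le> K"
    unfolding K_def using \<theta>(2)
    by (intro divide_nonneg_nonneg zero_le_power2 mult_nonneg_nonneg) linarith+
  have shift: "trans_op P (\<lambda>y. g y + d) x = m + d" for d
    by (simp add: trans_op_add const m_def)
  \<comment> \<open>All neighbour values lie within \<open>\<alpha> / 2\<close> of \<open>c\<close>,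
    hence so does their mean; two points of that interval are at most \<open>\<alpha>\<close>
    apart.\<close>
  have dist: "\<bar>g y - m\<bar> \<le> \<alpha>" if "y \<in> nbrs P x" for y
  proof -
    have near: "c - \<alpha> / 2 \<le> g y" "g y \<le> c + \<alpha> / 2" if "y \<in> nbrs P x" for y
      using jump[OF that] by (simp_all add: abs_if field_simps split: if_splits)
    have "trans_op P g x \<le> trans_op P (\<lambda>_. c + \<alpha> / 2) x"
      by (intro trans_op_mono nn near)
    moreover have "trans_op P (\<lambda>_. c - \<alpha> / 2) x \<le> trans_op P g x"
      by (intro trans_op_mono nn near)
    ultimately show ?thesis
      using near[OF that] unfolding const m_def by linarith
  qed
  \<comment> \<open>The second moment about \<open>c\<close> exceeds the one about the mean by
    exactly \<open>(m - c)\<^sup>2\<close>.\<close>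
  have "trans_op P (\<lambda>y. (g y - m)\<^sup>2) x = trans_op P (\<lambda>y. (g y - c)\<^sup>2 + (2 * (c - m) * g y + (m\<^sup>2 - c\<^sup>2))) x"
    by (intro arg_cong[where f="\<lambda>h. trans_op P h x"]) (simp add: fun_eq_iff power2_eq_square algebra_simps)
  also have "\<dots> = trans_op P (\<lambda>y. (g y - c)\<^sup>2) x - (m - c)\<^sup>2"
    by (simp only: trans_op_add trans_op_cmult const m_def[symmetric])
      (simp add: power2_eq_square algebra_simps)
  finally have var': "trans_op P (\<lambda>y. (g y - m)\<^sup>2) x \<le> v"
    using var zero_le_power2[of "m - c"] by linarith
  have "trans_op P (\<lambda>y. exp (\<theta> * g y)) x
      = exp (\<theta> * m) * trans_op P (\<lambda>y. exp (\<theta> * (g y - m))) x"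
    unfolding trans_op_cmult[symmetric] by (simp add: algebra_simps flip: exp_add)
  \<comment> \<open>Centred at the mean, the linear term averages to zero. It is written with
    \<open>+ - m\<close> so that \<open>shift\<close> applies to it.\<close>
  also have "trans_op P (\<lambda>y. exp (\<theta> * (g y - m))) x
      \<le> trans_op P (\<lambda>y. \<theta> * (g y + - m) + (1 + K * (g y - m)\<^sup>2)) x"
  proof (intro trans_op_mono nn)
    fix y assume "y \<in> nbrs P x"
    then have "\<bar>\<theta> * (g y - m)\<bar> \<le> \<theta> * \<alpha>"
      using \<theta> dist by (simp add: abs_mult mult_left_mono)
    from exp_le_Bernstein[OF this \<theta>(2)]
    show "exp (\<theta> * (g y - m)) \<le> \<theta> * (g y + - m) + (1 + K * (g y - m)\<^sup>2)"
      by (simp add: K_def power_mult_distrib)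
  qed
  also have "\<dots> = 1 + K * trans_op P (\<lambda>y. (g y - m)\<^sup>2) x"
    by (simp only: trans_op_add[of P "\<lambda>y. \<theta> * (g y + - m)"] trans_op_add[of P "\<lambda>_. 1"]
        trans_op_cmult shift const) simp
  also have "\<dots> \<le> 1 + K * v"
    using var' K by (simp add: mult_left_mono)
  also have "\<dots> \<le> exp (K * v)"
    by (rule exp_ge_add_one_self)
  finally show ?thesis
    by (simp add: K_def m_def exp_add)
qed

section \<open>Exponential moments on confined paths and the one-sided tail bound\<close>

context markov_chain_from
begin

text \<open>The indicator looks one step less far than the exponential: it is settled at time s and
  places \<open>X s\<close> in \<open>I\<close>, so \<open>trans_op_exp_le\<close> applies to the
  step to time \<open>Suc s\<close>. For \<open>s = t - 1\<close> the exponent contains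
  \<open>g (X t)\<close> itself and all of \<open>v 0, ..., v (t - 1)\<close>.\<close>

lemma expectation_exp_le:
  fixes g :: "'s \<Rightarrow> real"
  assumes fin: "\<And>x. finite (nbrs P x)"
    and \<theta>: "0 \<le> \<theta>" "\<theta> * \<alpha> < 3"
    and var: "\<And>i x. i < t \<Longrightarrow> x \<in> I \<Longrightarrow>
      trans_op P (\<lambda>y. ((trans_op P ^^ i) g y - (trans_op P ^^ i) g x)\<^sup>2) x \<le> v i"
    and jump: "\<And>i x y. i < t \<Longrightarrow> x \<in> I \<Longrightarrow> y \<in> nbrs P x \<Longrightarrow>
      2 * \<bar>(trans_op P ^^ i) g y - (trans_op P ^^ i) g x\<bar> \<le> \<alpha>"
    and s: "s < t"
  shows "expectation (\<lambda>\<omega>. indicator (cylinder s (\<lambda>_. I)) \<omega>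
        * exp (\<theta> * (trans_op P ^^ (t - Suc s)) g (X (Suc s) \<omega>)))
    \<le> exp (\<theta> * (trans_op P ^^ t) g x
        + \<theta>\<^sup>2 / (2 * (1 - \<theta> * \<alpha> / 3)) * (\<Sum>i\<in>{t - Suc s..<t}. v i))"
proof -
  define h where "h i = (trans_op P ^^ i) g" for i
  define K where "K = \<theta>\<^sup>2 / (2 * (1 - \<theta> * \<alpha> / 3))"
  let ?E = "\<lambda>s i m. expectation (\<lambda>\<omega>. indicator (cylinder s (\<lambda>_. I)) \<omega> * exp (\<theta> * h i (X m \<omega>)))"
  have h_Suc: "h (Suc i) = trans_op P (h i)" for i
    by (simp add: h_def)
  have step: "?E s (t - Suc s) (Suc s) \<le> exp (K * v (t - Suc s)) * ?E s (t - s) s" if "s < t" for s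
  proof -
    let ?i = "t - Suc s"
    have i: "?i < t" "t - s = Suc ?i"
      using that by auto
    have "trans_op P (\<lambda>y. exp (\<theta> * h ?i y)) z \<le> exp (K * v ?i) * exp (\<theta> * h (t - s) z)"
      if "z \<in> I" for z
      using trans_op_exp_le[OF stochastic fin \<theta> var[OF i(1) that] jump[OF i(1) that]]
      by (simp add: i(2) h_Suc K_def h_def add.commute flip: exp_add)
    then have "indicator (cylinder s (\<lambda>_. I)) \<omega> * trans_op P (\<lambda>y. exp (\<theta> * h ?i y)) (X s \<omega>)
        \<le> exp (K * v ?i) * (indicator (cylinder s (\<lambda>_. I)) \<omega> * exp (\<theta> * h (t - s) (X s \<omega>)))" for \<omega>
      by (auto simp: cylinder_def indicator_def)
    then have "expectation (\<lambda>\<omega>. indicator (cylinder s (\<lambda>_. I)) \<omega>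
          * trans_op P (\<lambda>y. exp (\<theta> * h ?i y)) (X s \<omega>))
        \<le> expectation (\<lambda>\<omega>. exp (K * v ?i)
          * (indicator (cylinder s (\<lambda>_. I)) \<omega> * exp (\<theta> * h (t - s) (X s \<omega>))))"
      using integrable_cylinder[OF fin]
        integrable_cylinder[OF fin, of s "\<lambda>_. I" "\<lambda>z. exp (\<theta> * h (t - s) z)" s]
      by (intro integral_mono) auto
    then show ?thesis
      using expectation_cylinder_step[OF fin, of s "\<lambda>_. I" "\<lambda>y. exp (\<theta> * h ?i y)"] by simp
  qed
  have "?E s (t - Suc s) (Suc s) \<le> exp (\<theta> * h t x + K * (\<Sum>i\<in>{t - Suc s..<t}. v i))"
    using s
  proof (induction s)
    case 0
    \<comment> \<open>At time 0 the confinement is simply dropped, and the start in \<open>x\<close>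
      makes the remaining expectation explicit.\<close>
    have "?E 0 t 0 \<le> expectation (\<lambda>\<omega>. exp (\<theta> * h t (X 0 \<omega>)))"
      using integrable_cylinder[OF fin, of 0 "\<lambda>_. I" "\<lambda>z. exp (\<theta> * h t z)" 0]
        integrable_comp_X[OF fin, of "\<lambda>z. exp (\<theta> * h t z)" 0]
      by (intro integral_mono) (auto simp: indicator_def)
    also have "\<dots> = exp (\<theta> * h t x)"
      by (simp add: expectation_eq_funpow_trans_op[OF fin, of "\<lambda>z. exp (\<theta> * h t z)"])
    finally have "exp (K * v (t - 1)) * ?E 0 t 0 \<le> exp (K * v (t - 1)) * exp (\<theta> * h t x)"
      by (intro mult_left_mono) auto
    moreover have "{t - Suc 0..<t} = {t - 1}"
      using 0 by auto
    ultimately show ?case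
      using step[OF 0] by (simp add: add.commute flip: exp_add)
  next
    case (Suc s)
    \<comment> \<open>Forgetting the constraint at time \<open>Suc s\<close> enlarges the cylinder,
      and the integrand is nonnegative; this brings in the induction hypothesis.\<close>
    have "?E (Suc s) (t - Suc s) (Suc s) \<le> ?E s (t - Suc s) (Suc s)"
      using integrable_cylinder[OF fin, of "Suc s" "\<lambda>_. I" "\<lambda>z. exp (\<theta> * h (t - Suc s) z)" "Suc s"]
        integrable_cylinder[OF fin, of s "\<lambda>_. I" "\<lambda>z. exp (\<theta> * h (t - Suc s) z)" "Suc s"]
      by (intro integral_mono) (auto simp: indicator_def cylinder_def)
    also have "\<dots> \<le> exp (\<theta> * h t x + K * (\<Sum>i\<in>{t - Suc s..<t}. v i))"
      using Suc by simp
    finally have "exp (K * v (t - Suc (Suc s))) * ?E (Suc s) (t - Suc s) (Suc s)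
        \<le> exp (K * v (t - Suc (Suc s))) * exp (\<theta> * h t x + K * (\<Sum>i\<in>{t - Suc s..<t}. v i))"
      by (intro mult_left_mono) auto
    also have "\<dots> = exp (\<theta> * h t x + K * (\<Sum>i\<in>insert (t - Suc (Suc s)) {t - Suc s..<t}. v i))"
      using Suc.prems by (simp add: algebra_simps flip: exp_add)
    also have "insert (t - Suc (Suc s)) {t - Suc s..<t} = {t - Suc (Suc s)..<t}"
      using Suc.prems by auto
    finally show ?case
      using step[OF Suc.prems] by simp
  qed
  then show ?thesis
    by (simp add: h_def K_def)
qed

text \<open>Chernoff's method: Markov's inequality for the exponential moment restricted to confined
  paths, with an explicit choice of the parameter.\<close>

lemma prob_upper_tail_le:
  fixes g :: "'s \<Rightarrow> real"
  assumes fin: "\<And>x. finite (nbrs P x)"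
    and var: "\<And>i x. i < t \<Longrightarrow> x \<in> I \<Longrightarrow>
      trans_op P (\<lambda>y. ((trans_op P ^^ i) g y - (trans_op P ^^ i) g x)\<^sup>2) x \<le> v i"
    and jump: "\<And>i x y. i < t \<Longrightarrow> x \<in> I \<Longrightarrow> y \<in> nbrs P x \<Longrightarrow>
      2 * \<bar>(trans_op P ^^ i) g y - (trans_op P ^^ i) g x\<bar> \<le> \<alpha>"
    and "0 < t" "0 \<le> \<alpha>" "0 < u"
    and V: "(\<Sum>i<t. v i) \<le> V" "0 < V"
  shows "prob {\<omega>\<in>space M. u \<le> g (X t \<omega>) - (trans_op P ^^ t) g x \<and> (\<forall>s<t. X s \<omega> \<in> I)}
    \<le> exp (- (u\<^sup>2 / (2 * V + 2 * \<alpha> * u / 3)))"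
proof -
  \<comment> \<open>With this choice \<open>1 - \<theta> * \<alpha> / 3\<close> equals
    \<open>V / W\<close>, so the exponent becomes
    \<open>u\<^sup>2 / (2 * W) - u\<^sup>2 / W\<close>, and \<open>2 * W\<close> is the denominator
    in the claim. Positivity of \<open>V\<close> gives
    \<open>\<theta> * \<alpha> < 3\<close>.\<close>
  define W where "W = V + \<alpha> * u / 3"
  define \<theta> where "\<theta> = u / W"
  have W: "0 < W" "V = W - \<alpha> * u / 3"
    using assms by (auto simp: W_def intro: add_pos_nonneg)
  have \<theta>: "0 < \<theta>" "\<theta> * \<alpha> < 3"
    using W assms by (auto simp: \<theta>_def field_simps)
  let ?C = "cylinder (t - Suc 0) (\<lambda>_. I)" and ?m = "(trans_op P ^^ t) g x"
  let ?F = "\<lambda>\<omega>. indicator ?C \<omega> * exp (\<theta> * g (X t \<omega>))"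
  have F: "integrable M ?F"
    using integrable_cylinder[OF fin, of _ _ "\<lambda>z. exp (\<theta> * g z)"] .
  have C: "\<omega> \<in> ?C \<longleftrightarrow> \<omega> \<in> space M \<and> (\<forall>s<t. X s \<omega> \<in> I)" for \<omega>
  proof -
    have "s \<le> t - Suc 0 \<longleftrightarrow> s < t" for s
      using \<open>0 < t\<close> by auto
    then show ?thesis
      by (simp add: cylinder_def)
  qed
  \<comment> \<open>The indicator equals one on this event, so confinement is absorbed into the
    random variable to which Markov's inequality is applied.\<close>
  have "{\<omega>\<in>space M. u \<le> g (X t \<omega>) - ?m \<and> (\<forall>s<t. X s \<omega> \<in> I)}
      \<subseteq> {\<omega>\<in>space M. exp (\<theta> * (u + ?m)) \<le> ?F \<omega>}"
    using \<theta> by (auto simp: C indicator_def)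
  then have "prob {\<omega>\<in>space M. u \<le> g (X t \<omega>) - ?m \<and> (\<forall>s<t. X s \<omega> \<in> I)}
      \<le> prob {\<omega>\<in>space M. exp (\<theta> * (u + ?m)) \<le> ?F \<omega>}"
    by (intro finite_measure_mono) measurable
  also have "\<dots> \<le> expectation ?F / exp (\<theta> * (u + ?m))"
    by (intro integral_Markov_inequality_measure[OF F, of "{}"]) auto
  also have "\<dots> \<le> exp (\<theta> * ?m + \<theta>\<^sup>2 / (2 * (1 - \<theta> * \<alpha> / 3)) * (\<Sum>i<t. v i)) / exp (\<theta> * (u + ?m))"
    using expectation_exp_le[OF fin _ \<theta>(2) var jump, where s="t - Suc 0" and t=t] \<theta> \<open>0 < t\<close>
    by (intro divide_right_mono) (simp_all add: atLeast0LessThan)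
  also have "\<dots> = exp (\<theta>\<^sup>2 / (2 * (1 - \<theta> * \<alpha> / 3)) * (\<Sum>i<t. v i) - \<theta> * u)"
    by (simp add: algebra_simps flip: exp_diff)
  also have "\<dots> \<le> exp (\<theta>\<^sup>2 / (2 * (1 - \<theta> * \<alpha> / 3)) * V - \<theta> * u)"
  proof -
    have "0 \<le> \<theta>\<^sup>2 / (2 * (1 - \<theta> * \<alpha> / 3))"
      using \<theta>(2) by (intro divide_nonneg_nonneg zero_le_power2 mult_nonneg_nonneg) linarith+
    from mult_left_mono[OF V(1) this] show ?thesis
      by (simp only: exp_le_cancel_iff diff_right_mono)
  qed
  also have "\<theta>\<^sup>2 / (2 * (1 - \<theta> * \<alpha> / 3)) * V - \<theta> * u = - (u\<^sup>2 / (2 * W))"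
  proof -
    have "1 - \<theta> * \<alpha> / 3 = V / W"
      using W by (simp add: \<theta>_def diff_divide_distrib mult.commute)
    then show ?thesis
      using W(1) V(2) by (simp add: \<theta>_def divide_simps power2_eq_square)
  qed
  finally show ?thesis
    by (simp add: W_def mult.assoc)
qed

end

theorem theorem2p3:
  fixes P :: "'s \<Rightarrow> 's \<Rightarrow> real"
    and M :: "'s \<Rightarrow> 'w measure"
    and X :: "nat \<Rightarrow> 'w \<Rightarrow> 's"
    and f :: "'s \<Rightarrow> real"
    and S0 :: "'s set"
    and a :: "'s \<Rightarrow> nat \<Rightarrow> 's \<Rightarrow> real"
    and \<alpha>s :: "nat \<Rightarrow> real"
    and t :: nat
    and \<alpha> \<beta> :: real
    and x0 :: 's
    and u :: real
  assumes chain: "\<And>x. markov_chain_from (M x) P X x"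
    and fin: "\<And>x. finite (nbrs P x)"
    and mean_diff: "\<And>i x y. x \<in> S0 \<Longrightarrow> y \<in> S0 \<Longrightarrow>
          \<bar>(\<integral>\<omega>. f (X i \<omega>) \<partial>M x) - (\<integral>\<omega>. f (X i \<omega>) \<partial>M y)\<bar> \<le> a x i y"
    and \<alpha>s_pos: "\<And>i. 0 < \<alpha>s i"
    and var_bound: "\<And>i. (SUP x\<in>inner_states P S0. ereal (trans_op P (\<lambda>y. (a x i y)\<^sup>2) x))
          \<le> ereal ((\<alpha>s i)\<^sup>2)"
    and t_pos: "0 < t"
    and \<beta>_eq: "\<beta> = 2 * (\<Sum>i=0..t-1. (\<alpha>s i)\<^sup>2)"
    and jump_bound: "2 * (SUP i\<in>{0..t-1}. SUP x\<in>inner_states P S0. SUP y\<in>nbrs P x. ereal (a x i y))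
          \<le> ereal \<alpha>"
    and u_pos: "0 < u"
  shows "\<P>(\<omega> in M x0. \<bar>f (X t \<omega>) - (\<integral>\<omega>'. f (X t \<omega>') \<partial>M x0)\<bar> \<ge> u
            \<and> (\<forall>s\<in>{0..t-1}. X s \<omega> \<in> inner_states P S0))
          \<le> 2 * exp (- (u\<^sup>2 / (2 * \<beta> + 2 * \<alpha> * u / 3)))"
\<comment> \<open>Without inner states the suprema are minus infinity and \<open>\<alpha>\<close>
  may be negative; but then the event is empty, as it demands an inner state at time 0.\<close>
proof (cases "inner_states P S0 = {}")
  case True
  then have *: "{\<omega> \<in> space (M x0). u \<le> \<bar>f (X t \<omega>) - (\<integral>\<omega>'. f (X t \<omega>') \<partial>M x0)\<bar>
      \<and> (\<forall>s\<in>{0..t-1}. X s \<omega> \<in> inner_states P S0)} = {}"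
    by auto
  show ?thesis
    unfolding * by simp
next
  case False
  interpret chain: markov_chain_from "M x" P X x for x
    by (rule chain)
  let ?I = "inner_states P S0"
  let ?h = "\<lambda>i. trans_op P ^^ i"
  have nn: "0 \<le> P x y" for x y
    using chain.stochastic by (auto simp: stochastic_matrix_def)
  have mean: "(\<integral>\<omega>. f (X i \<omega>) \<partial>M x) = ?h i f x" for i x
    by (rule chain.expectation_eq_funpow_trans_op[OF fin])
  \<comment> \<open>An inner state and all its neighbours lie in \<open>S0\<close>, which is what
    \<open>mean_diff\<close> asks for. This turns the bounds on \<open>a\<close> into bounds on
    differences of \<open>?h i f\<close>.\<close>
  have diff: "\<bar>?h i f y - ?h i f x\<bar> \<le> a x i y" if "x \<in> ?I" "y \<in> nbrs P x" for i x y
    using that mean_diff[of x y i] unfolding mean inner_states_def by auto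
  have var: "trans_op P (\<lambda>y. (?h i f y - ?h i f x)\<^sup>2) x \<le> (\<alpha>s i)\<^sup>2" if "x \<in> ?I" for i x
  proof -
    have "trans_op P (\<lambda>y. (?h i f y - ?h i f x)\<^sup>2) x \<le> trans_op P (\<lambda>y. (a x i y)\<^sup>2) x"
    proof (intro trans_op_mono nn)
      fix y assume "y \<in> nbrs P x"
      from power_mono[OF diff[OF that this] abs_ge_zero, of i 2]
      show "(?h i f y - ?h i f x)\<^sup>2 \<le> (a x i y)\<^sup>2"
        by simp
    qed
    moreover have "ereal (trans_op P (\<lambda>y. (a x i y)\<^sup>2) x) \<le> ereal ((\<alpha>s i)\<^sup>2)"
      using SUP_upper[OF that] var_bound[of i] by (rule order.trans)
    ultimately show ?thesis
      by simp
  qed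
  \<comment> \<open>The suprema are taken in the extended reals, so each value lies below them
    without a separate boundedness argument.\<close>
  have jump: "2 * a x i y \<le> \<alpha>" if "i < t" "x \<in> ?I" "y \<in> nbrs P x" for i x y
  proof -
    have "ereal (a x i y) \<le> (SUP y\<in>nbrs P x. ereal (a x i y))"
      using that by (intro SUP_upper)
    also have "\<dots> \<le> (SUP x\<in>?I. SUP y\<in>nbrs P x. ereal (a x i y))"
      using that by (intro SUP_upper)
    also have "\<dots> \<le> (SUP i\<in>{0..t-1}. SUP x\<in>?I. SUP y\<in>nbrs P x. ereal (a x i y))"
      using that by (intro SUP_upper[where f="\<lambda>i. SUP x\<in>?I. SUP y\<in>nbrs P x. ereal (a x i y)"]) auto
    finally have "2 * ereal (a x i y) \<le> 2 * \<dots>"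
      by (intro ereal_mult_left_mono) auto
    then have "2 * ereal (a x i y) \<le> ereal \<alpha>"
      using jump_bound by (rule order.trans)
    then show ?thesis
      by (simp add: numeral_eq_ereal)
  qed
  have jump': "2 * \<bar>?h i f y - ?h i f x\<bar> \<le> \<alpha>" if "i < t" "x \<in> ?I" "y \<in> nbrs P x" for i x y
    using jump[OF that] diff[OF that(2,3), of i] by argo
  obtain x where x: "x \<in> ?I"
    using False by auto
  \<comment> \<open>A row with sum one has a positive entry; the bound on that jump forces
    \<open>\<alpha>\<close> to be nonnegative.\<close>
  obtain y where y: "y \<in> nbrs P x"
    using stochastic_matrix_sum_nbrs[OF chain.stochastic fin, of x] by force
  have \<alpha>: "0 \<le> \<alpha>"
    by (rule order.trans[OF _ jump'[OF t_pos x y]]) simp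
  \<comment> \<open>\<open>\<beta>\<close> is twice this sum, so it can serve as the upper bound
    \<open>V\<close> in \<open>prob_upper_tail_le\<close>.\<close>
  have \<beta>: "(\<Sum>i<t. (\<alpha>s i)\<^sup>2) \<le> \<beta>" "0 < \<beta>"
  proof -
    have "{0..t-1} = {..<t}"
      using t_pos by auto
    moreover have "0 < (\<Sum>i<t. (\<alpha>s i)\<^sup>2)"
      using t_pos \<alpha>s_pos by (intro sum_pos) (auto simp: zero_less_power less_imp_neq[symmetric])
    ultimately show "(\<Sum>i<t. (\<alpha>s i)\<^sup>2) \<le> \<beta>" "0 < \<beta>"
      by (simp_all add: \<beta>_eq)
  qed
  \<comment> \<open>The two tails are the upper tails of \<open>f\<close> and of its negative; each
    contributes one exponential, hence the factor 2.\<close>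
  let ?U = "{\<omega>\<in>space (M x0). u \<le> f (X t \<omega>) - ?h t f x0 \<and> (\<forall>s<t. X s \<omega> \<in> ?I)}"
  let ?L = "{\<omega>\<in>space (M x0). u \<le> - f (X t \<omega>) - ?h t (\<lambda>y. - f y) x0 \<and> (\<forall>s<t. X s \<omega> \<in> ?I)}"
  have "{\<omega> \<in> space (M x0). u \<le> \<bar>f (X t \<omega>) - (\<integral>\<omega>'. f (X t \<omega>') \<partial>M x0)\<bar>
      \<and> (\<forall>s\<in>{0..t-1}. X s \<omega> \<in> ?I)} = ?U \<union> ?L"
    using t_pos unfolding mean funpow_trans_op_uminus by (auto simp: abs_if)
  moreover have "measure (M x0) (?U \<union> ?L) \<le> measure (M x0) ?U + measure (M x0) ?L"
    by (intro measure_Un_le) measurable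
  moreover have "measure (M x0) ?U \<le> exp (- (u\<^sup>2 / (2 * \<beta> + 2 * \<alpha> * u / 3)))"
    by (intro chain.prob_upper_tail_le[where v="\<lambda>i. (\<alpha>s i)\<^sup>2"] fin var jump' t_pos \<alpha> u_pos \<beta>)
  moreover have "measure (M x0) ?L \<le> exp (- (u\<^sup>2 / (2 * \<beta> + 2 * \<alpha> * u / 3)))"
  proof (intro chain.prob_upper_tail_le[where v="\<lambda>i. (\<alpha>s i)\<^sup>2"] fin t_pos \<alpha> u_pos \<beta>)
    show "trans_op P (\<lambda>y. (?h i (\<lambda>y. - f y) y - ?h i (\<lambda>y. - f y) x)\<^sup>2) x \<le> (\<alpha>s i)\<^sup>2"
      if "x \<in> ?I" for i x
      using var[OF that, of i] by (simp add: funpow_trans_op_uminus power2_commute)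
    show "2 * \<bar>?h i (\<lambda>y. - f y) y - ?h i (\<lambda>y. - f y) x\<bar> \<le> \<alpha>"
      if "i < t" "x \<in> ?I" "y \<in> nbrs P x" for i x y
      using jump'[OF that] by (simp add: funpow_trans_op_uminus abs_minus_commute)
  qed
  ultimately show ?thesis
    by simp
qed

end
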